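(* Let $b\geq 2$ be an integer and let $A=(a_n)_{n=1}^{\infty}$ be a strictly increasing sequence of positive integers with $\eta:=\limsup_{n\to\infty}\frac{a_{n+1}}{a_n}<+\infty$. Let $\theta$ and $\hat v$ be positive real numbers with $\hat v<\eta$. (1) If $\theta<\max\left\{1,\frac{1}{\eta-\hat v}\right\}$, then $$\hat{\mathcal V}_{b,A}(\hat v)\cap\mathcal V^{\ast}_{b,A}(\theta\hat v)=\emptyset.$$ (2) If $\theta\ge\max\left\{1,\frac{1}{\eta-\hat v}\right\}$, then $$\dim_{\rm H}\big(\hat{\mathcal V}_{b,A}(\hat v)\cap\mathcal V^{\ast}_{b,A}(\theta\hat v)\big)\le\frac{\eta\theta-1-\theta\hat v}{(\eta\theta-1)(1+\theta\hat v)}.$$ (3) Moreover, for every $\theta\ge\max\left\{1,\frac{1}{\eta-\hat v}\right\}$ and all $\rho\ge 0$, $$\dim_{\rm H}\big(\{\xi\in\mathbb R:\hat v_{b,A}(\xi)\ge\hat v\ \text{and}\ \theta\hat v\le v_{b,A}(\xi)\le\theta\hat v+\rho\}\big)\le\frac{\hat v(\eta\theta-1-\theta\hat v)+\rho(\eta-\hat v)}{(1+\theta\hat v)\big((\eta\theta-1)\hat v+\eta\rho\big)}.$$ (4) Furthermore, $\dim_{\rm H}(\hat{\mathcal V}_{b,A}(\eta))=0$.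
   Context: $\|x\|$ denotes the distance from $x\in\mathbb R$ to the nearest integer; $\dim_{\rm H}$ is Hausdorff dimension. For real $\xi$, $$v_{b,A}(\xi):=\sup\{v\ge 0:\ \|b^{a_n}\xi\|<(b^{a_n})^{-v}\ \text{for infinitely many } n\in\mathbb N\}\in[0,+\infty],$$ $$\hat v_{b,A}(\xi):=\sup\Big\{\hat v\ge 0:\ \text{for all sufficiently large integers }N,\ \min_{1\le n\le N}\|b^{a_n}\xi\|<(b^{a_N})^{-\hat v}\Big\}\in[0,+\infty].$$ (The exponents are introduced for irrational $\xi$; for rational $\xi$ the same formulas are used.) For $v\in[0,+\infty]$, $\mathcal V^{\ast}_{b,A}(v):=\{\xi\in\mathbb R:v_{b,A}(\xi)=v\}$, and for $\hat v\in[0,\eta]$, $\hat{\mathcal V}_{b,A}(\hat v):=\{\xi\in\mathbb R:\hat v_{b,A}(\xi)\ge\hat v\}$. *)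

theory Defs
  imports "HOL-Analysis.Analysis"
begin

definition dist_nearest_int :: "real \<Rightarrow> real"
  where "dist_nearest_int x = \<bar>x - of_int (round x)\<bar>"

text \<open>Sequences are indexed by the integers \<open>n \<ge> 1\<close>; the value \<open>a 0\<close> is never used.
  Both exponents are suprema in \<open>[0, \<infinity>]\<close> of sets of reals that always contain \<open>0\<close>.\<close>

definition exponent_v :: "nat \<Rightarrow> (nat \<Rightarrow> nat) \<Rightarrow> real \<Rightarrow> ereal"
  where "exponent_v b a \<xi> =
    Sup {ereal v | v. v \<ge> 0 \<and>
      infinite {n. n \<ge> 1 \<and> dist_nearest_int (real b ^ a n * \<xi>) < (real b ^ a n) powr (- v)}}"

definition exponent_v_hat :: "nat \<Rightarrow> (nat \<Rightarrow> nat) \<Rightarrow> real \<Rightarrow> ereal"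
  where "exponent_v_hat b a \<xi> =
    Sup {ereal v | v. v \<ge> 0 \<and>
      (\<forall>\<^sub>F N in sequentially.
        Min ((\<lambda>n. dist_nearest_int (real b ^ a n * \<xi>)) ` {1..N}) < (real b ^ a N) powr (- v))}"

definition V_star :: "nat \<Rightarrow> (nat \<Rightarrow> nat) \<Rightarrow> ereal \<Rightarrow> real set"
  where "V_star b a v = {\<xi>. exponent_v b a \<xi> = v}"

definition V_hat :: "nat \<Rightarrow> (nat \<Rightarrow> nat) \<Rightarrow> real \<Rightarrow> real set"
  where "V_hat b a v = {\<xi>. exponent_v_hat b a \<xi> \<ge> ereal v}"

text \<open>The term \<open>(diam U)\<^sup>s\<close> in Hausdorff sums, with \<open>0\<^sup>0 = 1\<close> for nonempty \<open>U\<close>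
  (whereas \<open>0 powr 0 = 0\<close>), so that the \<open>0\<close>-dimensional measure is the counting measure.\<close>

definition diam_pow :: "real \<Rightarrow> 'a::metric_space set \<Rightarrow> ennreal"
  where "diam_pow s U =
    (if U = {} then 0 else if s = 0 then 1 else ennreal (diameter U powr s))"

text \<open>Boundedness is required explicitly because \<open>diameter\<close> is unspecified on unbounded sets.
  Finite covers are included, since members of a cover may be empty.\<close>

definition hausdorff_premeasure :: "real \<Rightarrow> real \<Rightarrow> 'a::metric_space set \<Rightarrow> ennreal"
  where "hausdorff_premeasure \<delta> s E =
    Inf {(\<Sum>i. diam_pow s (U i)) | U :: nat \<Rightarrow> 'a set.
      E \<subseteq> (\<Union>i. U i) \<and> (\<forall>i. bounded (U i) \<and> diameter (U i) \<le> \<delta>)}"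

definition hausdorff_measure :: "real \<Rightarrow> 'a::metric_space set \<Rightarrow> ennreal"
  where "hausdorff_measure s E = (SUP \<delta>\<in>{0<..}. hausdorff_premeasure \<delta> s E)"

definition hausdorff_dim :: "'a::metric_space set \<Rightarrow> ereal"
  where "hausdorff_dim E = Inf {ereal s | s. s \<ge> 0 \<and> hausdorff_measure s E = 0}"

end

theory Submission
  imports Defs
begin

text \<open>Write \<open>d n\<close> for the distance of \<open>b ^ a n * \<xi>\<close> to the nearest integer. Consider the record
  indices \<open>n\<close>, where \<open>d n\<close> is smaller than all previous values. If \<open>m < n\<close> is the record where the
  minimum of \<open>d\<close> over \<open>{1..n - 1}\<close> is attained, then the uniform exponent and the growth bound on
  \<open>a\<close> give \<open>d m \<le> b powr (- c * a n)\<close> with \<open>c\<close> close to \<open>vh / \<eta>\<close>. Comparing with the lower bound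
  \<open>d m \<ge> b powr (- W * a m)\<close>, \<open>W\<close> slightly larger than the exponent, gives \<open>a m \<ge> (c / W) * a n\<close>,
  and since \<open>d n < d m\<close> the multiplication by \<open>b ^ (a n - a m)\<close> must have wrapped around, so
  \<open>b ^ (a n - a m) * d m \<ge> 1/2\<close>. These relations imply the emptiness statement. For the dimension,
  the nearest integer at \<open>n\<close> is determined by the one at \<open>m\<close> up to \<open>O(b powr ((1 - c) * a n - a m))\<close>
  choices. By induction there are at most \<open>K * b powr (\<gamma> * a n)\<close> possible nearest integers at a
  record \<open>n\<close>, as soon as \<open>1 - c - (1 - \<gamma>) * c / W < \<gamma>\<close>; the intervals of radius
  \<open>b powr (- (1 + \<tau>) * a n)\<close> around the corresponding \<open>b\<close>-adic rationals cover every point infinitely often. If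
  the uniform exponent is at least \<open>\<eta>\<close>, then the exponent is infinite and the trivial count
  \<open>\<gamma> = 1\<close> suffices.\<close>

section \<open>Hausdorff null sets\<close>

lemma hausdorff_premeasure_le:
  assumes "E \<subseteq> (\<Union>i. U i)" "\<And>i. bounded (U i) \<and> diameter (U i) \<le> \<delta>"
  shows "hausdorff_premeasure \<delta> s E \<le> (\<Sum>i. diam_pow s (U i))"
  unfolding hausdorff_premeasure_def using assms by (intro Inf_lower) blast

lemma hausdorff_measure_eq_0_iff:
  "hausdorff_measure s E = 0 \<longleftrightarrow> (\<forall>\<delta>>0. hausdorff_premeasure \<delta> s E = 0)"
proof
  assume "hausdorff_measure s E = 0"
  then have "hausdorff_premeasure \<delta> s E \<le> 0" if "\<delta> > 0" for \<delta>
    unfolding hausdorff_measure_def using that by (metis SUP_upper greaterThan_iff)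
  then show "\<forall>\<delta>>0. hausdorff_premeasure \<delta> s E = 0" by simp
qed (auto simp: hausdorff_measure_def intro!: antisym SUP_least)

text \<open>Covers indexed by pairs suit both later uses, where a cover arises as a sequence of
  families. \<open>prod_decode\<close> flattens it to a sequence, and rearranging the sum is
  harmless because all terms are nonnegative.\<close>

lemma hausdorff_measure_eq_0I:
  assumes "\<And>\<delta> e. \<delta> > 0 \<Longrightarrow> e > 0 \<Longrightarrow>
    \<exists>U :: nat \<times> nat \<Rightarrow> 'a::metric_space set. E \<subseteq> (\<Union>p. U p) \<and>
      (\<forall>p. bounded (U p) \<and> diameter (U p) \<le> \<delta>) \<and>
      (\<Sum>j. \<Sum>i. diam_pow s (U (j, i))) \<le> ennreal e"
  shows "hausdorff_measure s E = 0"
  unfolding hausdorff_measure_eq_0_iff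
proof (intro allI impI)
  fix \<delta> :: real assume "\<delta> > 0"
  have "hausdorff_premeasure \<delta> s E \<le> 0 + ennreal e" if "e > 0" for e
  proof -
    obtain U :: "nat \<times> nat \<Rightarrow> 'a set" where U: "E \<subseteq> (\<Union>p. U p)"
      "\<And>p. bounded (U p) \<and> diameter (U p) \<le> \<delta>"
      "(\<Sum>j. \<Sum>i. diam_pow s (U (j, i))) \<le> ennreal e"
      using assms[OF \<open>\<delta> > 0\<close> \<open>e > 0\<close>] by blast
    have "E \<subseteq> (\<Union>i. U (prod_decode i))"
    proof
      fix x assume "x \<in> E"
      then obtain p where "x \<in> U p" using U(1) by blast
      then show "x \<in> (\<Union>i. U (prod_decode i))" by (auto intro!: exI[of _ "prod_encode p"])
    qed
    then have "hausdorff_premeasure \<delta> s E \<le> (\<Sum>i. diam_pow s (U (prod_decode i)))"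
      using U(2) by (intro hausdorff_premeasure_le) auto
    also have "\<dots> = (\<Sum>j. \<Sum>i. diam_pow s (U (j, i)))"
      by (rule suminf_ennreal_2dimen[where f = "\<lambda>p. diam_pow s (U p)"]) simp
    finally show ?thesis using U(3) by simp
  qed
  then have "hausdorff_premeasure \<delta> s E \<le> 0" by (rule ennreal_le_epsilon)
  then show "hausdorff_premeasure \<delta> s E = 0" by simp
qed

lemma hausdorff_null_UN:
  fixes E :: "nat \<Rightarrow> 'a::metric_space set"
  assumes "\<And>j. hausdorff_measure s (E j) = 0"
  shows "hausdorff_measure s (\<Union>j. E j) = 0"
proof (rule hausdorff_measure_eq_0I)
  fix \<delta> e :: real assume pos: "\<delta> > 0" "e > 0"
  have "\<exists>U :: nat \<Rightarrow> 'a set. E j \<subseteq> (\<Union>i. U i) \<and> (\<forall>i. bounded (U i) \<and> diameter (U i) \<le> \<delta>) \<and>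
      (\<Sum>i. diam_pow s (U i)) < ennreal (e * (1/2) ^ Suc j)" for j
  proof -
    have "hausdorff_premeasure \<delta> s (E j) < ennreal (e * (1/2) ^ Suc j)"
      using assms[of j] pos by (simp add: hausdorff_measure_eq_0_iff)
    then show ?thesis unfolding hausdorff_premeasure_def Inf_less_iff by blast
  qed
  then have "\<forall>j. \<exists>U :: nat \<Rightarrow> 'a set. E j \<subseteq> (\<Union>i. U i) \<and> (\<forall>i. bounded (U i) \<and> diameter (U i) \<le> \<delta>) \<and>
      (\<Sum>i. diam_pow s (U i)) < ennreal (e * (1/2) ^ Suc j)" by blast
  from choice[OF this] obtain U :: "nat \<Rightarrow> nat \<Rightarrow> 'a set" where U: "\<And>j. E j \<subseteq> (\<Union>i. U j i)"
    "\<And>j i. bounded (U j i) \<and> diameter (U j i) \<le> \<delta>"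
    "\<And>j. (\<Sum>i. diam_pow s (U j i)) < ennreal (e * (1/2) ^ Suc j)" by blast
  have sums: "(\<lambda>j. e * (1/2) ^ Suc j) sums (e * 1)"
    by (intro sums_mult power_half_series)
  have "(\<Sum>j. \<Sum>i. diam_pow s (U j i)) \<le> (\<Sum>j. ennreal (e * (1/2) ^ Suc j))"
    using U(3) by (intro suminf_le) (auto simp: less_imp_le)
  also have "\<dots> = ennreal (\<Sum>j. e * (1/2) ^ Suc j)"
    using pos sums by (intro suminf_ennreal2) (auto simp: sums_iff)
  also have "\<dots> = ennreal e" using sums by (simp add: sums_iff)
  finally show "\<exists>U :: nat \<times> nat \<Rightarrow> 'a set. (\<Union>j. E j) \<subseteq> (\<Union>p. U p) \<and>
      (\<forall>p. bounded (U p) \<and> diameter (U p) \<le> \<delta>) \<and>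
      (\<Sum>j. \<Sum>i. diam_pow s (U (j, i))) \<le> ennreal e"
  proof (intro exI[of _ "\<lambda>(j, i). U j i"] conjI)
    show "(\<Union>j. E j) \<subseteq> (\<Union>p. case p of (j, i) \<Rightarrow> U j i)"
    proof
      fix x assume "x \<in> (\<Union>j. E j)"
      then obtain j i where "x \<in> U j i" using U(1) by blast
      then show "x \<in> (\<Union>p. case p of (j, i) \<Rightarrow> U j i)" by (auto intro!: exI[of _ "(j, i)"])
    qed
  qed (use U(2) in auto)
qed

lemma hausdorff_null_subset:
  assumes "hausdorff_measure s F = 0" "E \<subseteq> F"
  shows "hausdorff_measure s E = 0"
proof -
  have "hausdorff_premeasure \<delta> s E \<le> hausdorff_premeasure \<delta> s F" for \<delta>
    unfolding hausdorff_premeasure_def using assms(2) by (intro Inf_superset_mono) blast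
  then show ?thesis using assms(1) unfolding hausdorff_measure_eq_0_iff
    by (metis le_zero_eq)
qed

lemma diameter_cball_le:
  fixes x :: "'a::metric_space"
  assumes "r \<ge> 0"
  shows "diameter (cball x r) \<le> 2 * r"
proof -
  have "dist y z \<le> 2 * r" if "y \<in> cball x r" "z \<in> cball x r" for y z
    using dist_triangle3[of y z x] that by simp
  then show ?thesis
    using assms unfolding diameter_def by (auto intro!: cSUP_least)
qed

lemma diam_pow_cball_le:
  assumes "s > 0" "r \<ge> 0"
  shows "diam_pow s (cball x r) \<le> ennreal ((2 * r) powr s)"
proof -
  have "diameter (cball x r) \<le> 2 * r"
    by (intro diameter_cball_le assms)
  then show ?thesis unfolding diam_pow_def using assms
    by (auto intro!: ennreal_leI powr_mono2 diameter_ge_0)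
qed

text \<open>Convergence half of Borel-Cantelli: every tail of the families of balls covers
  \<open>E\<close>, since each point is hit infinitely often, and the Hausdorff sums of the tails
  tend to 0.\<close>

lemma hausdorff_null_limsup:
  fixes C :: "nat \<Rightarrow> 'a::metric_space set"
  assumes "s > 0" and fin: "\<And>n. finite (C n)" and r: "\<And>n. r n \<ge> 0" "r \<longlonglongrightarrow> 0"
    and sum: "summable (\<lambda>n. real (card (C n)) * (2 * r n) powr s)"
    and E: "\<And>x. x \<in> E \<Longrightarrow> \<exists>\<^sub>\<infinity>n. \<exists>c\<in>C n. dist c x \<le> r n"
  shows "hausdorff_measure s E = 0"
proof (rule hausdorff_measure_eq_0I)
  fix \<delta> e :: real assume pos: "\<delta> > 0" "e > 0"
  let ?g = "\<lambda>n. real (card (C n)) * (2 * r n) powr s"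
  obtain P1 where P1: "\<And>n. n \<ge> P1 \<Longrightarrow> norm (\<Sum>i. ?g (i + n)) < e"
    using suminf_exist_split[OF pos(2) sum] by blast
  obtain P2 where P2: "\<And>n. n \<ge> P2 \<Longrightarrow> norm (r n - 0) < \<delta> / 2"
    using LIMSEQ_D[OF r(2), of "\<delta> / 2"] pos by auto
  define P where "P = max P1 P2"
  obtain h where h: "\<And>n. bij_betw (h n) {0..<card (C n)} (C n)"
    using ex_bij_betw_nat_finite[OF fin] by metis
  \<comment> \<open>The shift by \<open>P\<close> keeps only a tail whose total cost is below
    \<open>e\<close> and whose diameters are at most \<delta>. Indices beyond the cardinality are
    filled with the empty set, which costs nothing.\<close>
  define U where "U = (\<lambda>(n, i). if i < card (C (n + P)) then cball (h (n + P) i) (r (n + P)) else {})"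
  have diam: "diameter (cball x (r (n + P))) \<le> \<delta>" for x :: 'a and n
  proof -
    have "2 * r (n + P) \<le> \<delta>" using P2[of "n + P"] by (simp add: P_def trans_le_add2)
    then show ?thesis using diameter_cball_le[OF r(1), of x "n + P"] by linarith
  qed
  have "(\<Sum>j. \<Sum>i. diam_pow s (U (j, i))) \<le> (\<Sum>j. ennreal (?g (j + P)))"
  proof (intro suminf_le)
    fix j
    have "(\<Sum>i. diam_pow s (U (j, i))) = (\<Sum>i<card (C (j + P)). diam_pow s (U (j, i)))"
      by (rule suminf_finite) (auto simp: U_def diam_pow_def)
    also have "\<dots> \<le> (\<Sum>i<card (C (j + P)). ennreal ((2 * r (j + P)) powr s))"
      by (intro sum_mono) (auto simp: U_def intro!: diam_pow_cball_le assms)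
    also have "\<dots> = ennreal (?g (j + P))"
      by (simp add: ennreal_mult ennreal_of_nat_eq_real_of_nat)
    finally show "(\<Sum>i. diam_pow s (U (j, i))) \<le> ennreal (?g (j + P))" .
  qed auto
  also have "\<dots> = ennreal (\<Sum>j. ?g (j + P))"
    using sum by (intro suminf_ennreal2) (auto intro: summable_ignore_initial_segment)
  also have "\<dots> \<le> ennreal e" using P1[of P] by (intro ennreal_leI) (auto simp: P_def)
  finally have total: "(\<Sum>j. \<Sum>i. diam_pow s (U (j, i))) \<le> ennreal e" .
  have "E \<subseteq> (\<Union>p. U p)"
  proof
    fix x assume "x \<in> E"
    then obtain n c where n: "n \<ge> P" "c \<in> C n" "dist c x \<le> r n"
      using E unfolding INFM_nat_le by blast
    obtain i where "i < card (C n)" "h n i = c"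
      using bij_betw_imp_surj_on[OF h[of n]] n(2) by (metis atLeastLessThan_iff imageE)
    then have "x \<in> U (n - P, i)" using n by (auto simp: U_def)
    then show "x \<in> (\<Union>p. U p)" by blast
  qed
  then show "\<exists>U :: nat \<times> nat \<Rightarrow> 'a set. E \<subseteq> (\<Union>p. U p) \<and>
      (\<forall>p. bounded (U p) \<and> diameter (U p) \<le> \<delta>) \<and>
      (\<Sum>j. \<Sum>i. diam_pow s (U (j, i))) \<le> ennreal e"
  proof (intro exI[of _ U] conjI)
    show "\<forall>p. bounded (U p) \<and> diameter (U p) \<le> \<delta>"
      using diam pos by (simp add: U_def split: prod.split)
  qed (use total in auto)
qed

lemma hausdorff_dim_le:
  assumes "B \<ge> 0" "\<And>s. s > B \<Longrightarrow> hausdorff_measure s E = 0"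
  shows "hausdorff_dim E \<le> ereal B"
proof (rule ereal_le_epsilon2)
  fix e :: real assume "e > 0"
  then show "hausdorff_dim E \<le> ereal B + ereal e"
    unfolding hausdorff_dim_def using assms by (intro Inf_lower) auto
qed

lemma hausdorff_dim_mono:
  assumes "E \<subseteq> F"
  shows "hausdorff_dim E \<le> hausdorff_dim F"
  unfolding hausdorff_dim_def using hausdorff_null_subset[OF _ assms]
  by (intro Inf_superset_mono) blast

lemma hausdorff_dim_nonneg: "hausdorff_dim E \<ge> 0"
  unfolding hausdorff_dim_def by (intro Inf_greatest) auto

section \<open>Records\<close>

definition is_record :: "(nat \<Rightarrow> real) \<Rightarrow> nat \<Rightarrow> bool"
  where "is_record d n \<longleftrightarrow> n \<ge> 1 \<and> (\<forall>m\<in>{1..<n}. d n < d m)"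

text \<open>The leftmost minimiser works: being leftmost turns the weak inequalities against earlier
  values into strict ones.\<close>

lemma record_argmin:
  assumes "n \<ge> 1"
  obtains m where "m \<in> {1..n}" "is_record d m" "\<And>k. k \<in> {1..n} \<Longrightarrow> d m \<le> d k"
proof -
  let ?P = "\<lambda>m. m \<in> {1..n} \<and> d m = Min (d ` {1..n})"
  define m where "m = (LEAST m. ?P m)"
  have "Min (d ` {1..n}) \<in> d ` {1..n}" using assms by (intro Min_in) auto
  then have "\<exists>m. ?P m" by force
  then have m: "?P m" unfolding m_def by (rule LeastI_ex)
  have min: "d m \<le> d k" if "k \<in> {1..n}" for k using m that by simp
  have "d m < d k" if "k \<in> {1..<m}" for k
  proof -
    have "\<not> ?P k" using that not_less_Least[of k ?P] by (auto simp: m_def)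
    then show ?thesis using that m min[of k] by (auto simp: order.order_iff_strict)
  qed
  then show ?thesis using m min that[of m] by (auto simp: is_record_def)
qed

text \<open>By positivity, the minimum of an initial segment is a positive threshold; a later value
  below it pushes the minimiser beyond that segment.\<close>

lemma records_unbounded:
  assumes pos: "\<And>n. n \<ge> 1 \<Longrightarrow> d n > 0" and small: "\<And>e. e > 0 \<Longrightarrow> \<exists>n\<ge>1. d n < e"
  obtains n where "n \<ge> k" "is_record d n"
proof -
  \<comment> \<open>Running up to \<open>Suc k\<close> keeps the range nonempty when
    \<open>k = 0\<close>.\<close>
  have "Min (d ` {1..Suc k}) > 0" using pos by (subst Min_gr_iff) auto
  then obtain n where n: "n \<ge> 1" "d n < Min (d ` {1..Suc k})" using small by blast
  obtain m where m: "m \<in> {1..n}" "is_record d m" "\<And>k. k \<in> {1..n} \<Longrightarrow> d m \<le> d k"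
    using record_argmin[OF n(1)] by blast
  have "m \<ge> k"
  proof (rule ccontr)
    assume "\<not> m \<ge> k"
    then have "Min (d ` {1..Suc k}) \<le> d m" using m(1) by (intro Min_le) auto
    with m(3)[of n] n show False by auto
  qed
  with m(2) show ?thesis by (rule that[rotated])
qed

text \<open>The minimiser over \<open>{1..n}\<close> does at least as well as \<open>n\<close>: its
  value is no larger, and its threshold is no smaller because \<open>g\<close> decreases.\<close>

lemma small_value_imp_small_record:
  assumes "is_record d r" and small: "\<exists>\<^sub>\<infinity>n. d n < g n"
    and mono: "\<And>m n. 1 \<le> m \<Longrightarrow> m \<le> n \<Longrightarrow> g n \<le> g m"
  obtains m where "m \<ge> r" "is_record d m" "d m < g m"
proof -
  obtain n where n: "n \<ge> r" "d n < g n" using small unfolding INFM_nat_le by blast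
  have r: "r \<ge> 1" "\<And>m. m \<in> {1..<r} \<Longrightarrow> d r < d m" using assms(1) by (auto simp: is_record_def)
  have "n \<ge> 1" using n r by simp
  then obtain m where m: "m \<in> {1..n}" "is_record d m" "\<And>k. k \<in> {1..n} \<Longrightarrow> d m \<le> d k"
    using record_argmin by blast
  \<comment> \<open>A minimiser before \<open>r\<close> would be beaten by the record
    \<open>r\<close>, which also lies in \<open>{1..n}\<close>.\<close>
  have "m \<ge> r" using m(3)[of r] r(2)[of m] m(1) n(1) r(1) by force
  moreover have "d m < g m" using m(3)[of n] m(1) n(2) mono[of m n] by force
  ultimately show ?thesis using m(2) that by blast
qed

section \<open>Distances to the nearest integer\<close>

lemma dist_nearest_int_nonneg: "dist_nearest_int x \<ge> 0"
  unfolding dist_nearest_int_def by simp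

text \<open>The integer \<open>k * round x\<close> stays within 1/2 of \<open>k * x\<close>, so it
  is still the nearest one: no wrap-around occurs.\<close>

lemma dist_nearest_int_mult:
  assumes "real k * dist_nearest_int x < 1/2"
  shows "dist_nearest_int (real k * x) = real k * dist_nearest_int x"
proof -
  have *: "\<bar>real k * x - of_int (int k * round x)\<bar> = real k * dist_nearest_int x"
  proof -
    have "real k * x - of_int (int k * round x) = real k * (x - of_int (round x))"
      by (simp add: algebra_simps)
    then show ?thesis by (simp add: dist_nearest_int_def abs_mult)
  qed
  then have "round (real k * x) = int k * round x"
    using assms by (intro round_unique') simp
  then show ?thesis using * by (simp add: dist_nearest_int_def)
qed

lemma card_int_ball:
  fixes r :: real and k :: int
  assumes "r \<ge> 0"
  shows "finite {y :: int. \<bar>of_int y - of_int k\<bar> \<le> r}" (is "finite ?S")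
    and "real (card {y :: int. \<bar>of_int y - of_int k\<bar> \<le> r}) \<le> 2 * r + 1"
proof -
  have sub: "?S \<subseteq> {k - \<lfloor>r\<rfloor>..k + \<lfloor>r\<rfloor>}"
  proof
    fix y assume "y \<in> ?S"
    then have "real_of_int (y - k) \<le> r" "real_of_int (k - y) \<le> r" by auto
    then have "y - k \<le> \<lfloor>r\<rfloor>" "k - y \<le> \<lfloor>r\<rfloor>" by (simp_all add: le_floor_iff)
    then show "y \<in> {k - \<lfloor>r\<rfloor>..k + \<lfloor>r\<rfloor>}" by simp
  qed
  show "finite ?S" by (rule finite_subset[OF sub]) simp
  have "card ?S \<le> card {k - \<lfloor>r\<rfloor>..k + \<lfloor>r\<rfloor>}" by (rule card_mono[OF _ sub]) simp
  also have "\<dots> = nat (2 * \<lfloor>r\<rfloor> + 1)" by simp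
  finally have "real (card ?S) \<le> real (nat (2 * \<lfloor>r\<rfloor> + 1))" by (simp only: of_nat_le_iff)
  also have "\<dots> = 2 * of_int \<lfloor>r\<rfloor> + 1" using assms by simp
  also have "\<dots> \<le> 2 * r + 1" by simp
  finally show "real (card ?S) \<le> 2 * r + 1" .
qed

section \<open>Distances along the powers \<open>b ^ a n\<close>\<close>

locale digit_positions =
  fixes b :: nat and a :: "nat \<Rightarrow> nat"
  assumes b_ge: "b \<ge> 2" and a_pos: "\<And>n. n \<ge> 1 \<Longrightarrow> a n > 0"
    and a_mono: "strict_mono_on {1..} a"
begin

abbreviation B :: real where "B \<equiv> real b"

definition d :: "real \<Rightarrow> nat \<Rightarrow> real"
  where "d \<xi> n = dist_nearest_int (B ^ a n * \<xi>)"

lemma B_gt: "B > 1" "B > 0" "B \<noteq> 1" "B \<ge> 2"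
  using b_ge by auto

lemma powr_le_B [simp]: "B powr x \<le> B powr y \<longleftrightarrow> x \<le> y"
  using B_gt by simp

lemma a_less: "1 \<le> m \<Longrightarrow> m < n \<Longrightarrow> a m < a n"
  using a_mono by (auto simp: strict_mono_on_def)

lemma a_le: "1 \<le> m \<Longrightarrow> m \<le> n \<Longrightarrow> a m \<le> a n"
  using a_less[of m n] by (cases "m = n") auto

text \<open>This allows series in negative powers \<open>B powr (- \<sigma> * a n)\<close> to be
  compared with geometric series in \<open>n\<close>, and the number of indices below
  \<open>n\<close> to be bounded by \<open>a n\<close>.\<close>

lemma a_ge: "n \<ge> 1 \<Longrightarrow> n \<le> a n"
proof (induction n rule: dec_induct)
  case base then show ?case using a_pos[of 1] by simp
next
  case (step n) then show ?case using a_less[of n "Suc n"] by simp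
qed

lemma powr_a: "(B ^ a n) powr (- v) = B powr (- (v * real (a n)))"
  using B_gt by (simp add: powr_realpow[symmetric] powr_powr mult.commute)

lemma d_nonneg: "d \<xi> n \<ge> 0"
  by (simp add: d_def dist_nearest_int_nonneg)

lemma d_eq: "d \<xi> n = \<bar>B ^ a n * \<xi> - of_int (round (B ^ a n * \<xi>))\<bar>"
  by (simp add: d_def dist_nearest_int_def)

lemma d_later:
  assumes "1 \<le> m" "m \<le> n" "B ^ (a n - a m) * d \<xi> m < 1/2"
  shows "d \<xi> n = B ^ (a n - a m) * d \<xi> m"
proof -
  have "B ^ a n = B ^ (a n - a m) * B ^ a m"
    using a_le[OF assms(1,2)] by (simp flip: power_add)
  then show ?thesis
    using dist_nearest_int_mult[of "b ^ (a n - a m)" "B ^ a m * \<xi>"] assms(3)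
    by (simp add: d_def mult.assoc)
qed

text \<open>Without wrap-around, multiplying by a power of \<open>B\<close> cannot shrink the
  distance, so a smaller later value requires the product to reach 1/2.\<close>

lemma d_decrease:
  assumes "1 \<le> m" "m < n" "d \<xi> n < d \<xi> m"
  shows "1/2 \<le> B powr (real (a n) - real (a m)) * d \<xi> m"
proof -
  have "real (a n) - real (a m) = real (a n - a m)" using a_less[OF assms(1,2)] by simp
  then have eq: "B powr (real (a n) - real (a m)) = B ^ (a n - a m)"
    using B_gt by (simp only: powr_realpow)
  have "d \<xi> n = B ^ (a n - a m) * d \<xi> m" if "B ^ (a n - a m) * d \<xi> m < 1/2"
    using d_later that assms by simp
  moreover have "B ^ (a n - a m) * d \<xi> m \<ge> 1 * d \<xi> m"
    using B_gt by (intro mult_right_mono d_nonneg) (simp add: one_le_power)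
  ultimately show ?thesis unfolding eq using assms(3) by argo
qed

section \<open>Consequences of strict bounds on the two exponents\<close>

lemma exponent_v_lessD:
  assumes "exponent_v b a \<xi> < ereal W" "W \<ge> 0"
  shows "\<forall>\<^sub>F n in sequentially. B powr (- (W * real (a n))) \<le> d \<xi> n"
proof -
  have "finite {n. n \<ge> 1 \<and> d \<xi> n < B powr (- (W * real (a n)))}" (is "finite ?S")
  proof (rule ccontr)
    assume "infinite ?S"
    then have "ereal W \<le> exponent_v b a \<xi>" unfolding exponent_v_def
      using assms(2) by (intro Sup_upper) (auto simp: powr_a d_def)
    then show False using assms(1) by simp
  qed
  then obtain k where "\<And>n. n \<in> ?S \<Longrightarrow> n < k" using finite_nat_set_iff_bounded by auto
  then have "B powr (- (W * real (a n))) \<le> d \<xi> n" if "n \<ge> max 1 k" for n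
    using that by (metis (mono_tags, lifting) linorder_not_le max.boundedE mem_Collect_eq)
  then show ?thesis by (rule eventually_sequentiallyI)
qed

lemma exponent_v_gtD:
  assumes "ereal \<tau> < exponent_v b a \<xi>"
  shows "\<exists>\<^sub>\<infinity>n. n \<ge> 1 \<and> d \<xi> n < B powr (- (\<tau> * real (a n)))"
proof -
  obtain v where "\<tau> < v" and inf: "\<exists>\<^sub>\<infinity>n. n \<ge> 1 \<and> d \<xi> n < B powr (- (v * real (a n)))"
    using assms unfolding exponent_v_def less_Sup_iff
    by (auto simp: powr_a d_def frequently_cofinite)
  have "B powr (- (v * real (a n))) \<le> B powr (- (\<tau> * real (a n)))" for n
    using \<open>\<tau> < v\<close> by (simp add: mult_right_mono)
  then show ?thesis using inf by (elim frequently_elim1) (meson less_le_trans)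
qed

lemma exponent_v_hat_gtD:
  assumes "ereal u < exponent_v_hat b a \<xi>"
  shows "\<forall>\<^sub>F N in sequentially. Min (d \<xi> ` {1..N}) < B powr (- (u * real (a N)))"
proof -
  obtain v where "u < v"
    and ev: "\<forall>\<^sub>F N in sequentially. Min (d \<xi> ` {1..N}) < B powr (- (v * real (a N)))"
    using assms unfolding exponent_v_hat_def less_Sup_iff
    by (auto simp: powr_a d_def[abs_def])
  have "B powr (- (v * real (a n))) \<le> B powr (- (u * real (a n)))" for n
    using \<open>u < v\<close> by (simp add: mult_right_mono)
  then show ?thesis using ev by (elim eventually_mono) (meson less_le_trans)
qed

text \<open>A zero distance at \<open>n\<close> would persist at all later indices and contradict
  the eventual lower bound supplied by \<open>W\<close>.\<close>

lemma d_pos: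
  assumes "exponent_v b a \<xi> < ereal W" "W \<ge> 0" "n \<ge> 1"
  shows "d \<xi> n > 0"
proof (rule ccontr)
  assume "\<not> d \<xi> n > 0"
  then have 0: "d \<xi> n = 0" using d_nonneg[of \<xi> n] by simp
  have "\<forall>\<^sub>F m in sequentially. m \<ge> n \<and> B powr (- (W * real (a m))) \<le> d \<xi> m"
    using exponent_v_lessD[OF assms(1,2)] eventually_ge_at_top by (rule eventually_conj[rotated])
  then obtain m where "m \<ge> n" "B powr (- (W * real (a m))) \<le> d \<xi> m"
    using eventually_happens by force
  moreover have "d \<xi> m = 0" using d_later[OF assms(3) \<open>m \<ge> n\<close>] 0 by simp
  moreover have "B powr (- (W * real (a m))) > 0" using B_gt by simp
  ultimately show False by linarith
qed

lemma d_arbitrarily_small: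
  assumes "exponent_v_hat b a \<xi> \<ge> ereal vh" "vh > 0" "e > 0"
  shows "\<exists>n\<ge>1. d \<xi> n < e"
proof -
  \<comment> \<open>Halving \<open>vh\<close> makes the inequality strict while keeping a positive
    rate of decay.\<close>
  have "ereal (vh / 2) < exponent_v_hat b a \<xi>"
    using assms by (intro less_le_trans[OF _ assms(1)]) simp
  then have ev: "\<forall>\<^sub>F N in sequentially. Min (d \<xi> ` {1..N}) < B powr (- (vh / 2 * real (a N)))"
    by (rule exponent_v_hat_gtD)
  have "B powr (- (vh / 2)) < 1" using B_gt assms by (simp add: powr_less_one)
  then have "(\<lambda>N. (B powr (- (vh / 2))) ^ N) \<longlonglongrightarrow> 0" by (intro LIMSEQ_realpow_zero) auto
  then have "\<forall>\<^sub>F N in sequentially. (B powr (- (vh / 2))) ^ N < e"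
    using assms(3) by (rule order_tendstoD)
  with ev eventually_ge_at_top[of 1] have "\<forall>\<^sub>F N in sequentially. \<exists>n\<ge>1. d \<xi> n < e"
  proof eventually_elim
    case (elim N)
    have "(B powr (- (vh / 2))) ^ N = B powr (- (vh / 2 * real N))"
      using B_gt by (simp add: powr_realpow[symmetric] powr_powr)
    moreover have "B powr (- (vh / 2 * real (a N))) \<le> B powr (- (vh / 2 * real N))"
      using a_ge[of N] elim assms(2) by (simp add: mult_left_mono)
    ultimately have "Min (d \<xi> ` {1..N}) < e" using elim by linarith
    then show ?case using elim by (subst (asm) Min_less_iff) auto
  qed
  then show ?thesis using eventually_happens by force
qed

section \<open>Relations between consecutive records\<close>

lemma records_exist:
  assumes "exponent_v_hat b a \<xi> \<ge> ereal vh" "vh > 0" "exponent_v b a \<xi> < ereal W" "W \<ge> 0"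
  obtains n where "n \<ge> k" "is_record (d \<xi>) n"
  using records_unbounded[of "d \<xi>" k] d_arbitrarily_small[OF assms(1,2)] d_pos[OF assms(3,4)]
  by blast

text \<open>Here \<open>m\<close> need only be some record before \<open>n\<close> satisfying the relations between consecutive
  records; \<open>\<kappa>\<close> plays the role of \<open>c / W\<close>.\<close>

definition pred_record :: "real \<Rightarrow> real \<Rightarrow> real \<Rightarrow> nat \<Rightarrow> nat \<Rightarrow> bool"
  where "pred_record c \<kappa> \<xi> n m \<longleftrightarrow> 1 \<le> m \<and> m < n \<and> is_record (d \<xi>) m \<and>
    \<kappa> * real (a n) \<le> real (a m) \<and> d \<xi> m \<le> B powr (- (c * real (a n))) \<and>
    1/2 \<le> B powr (real (a n) - real (a m)) * d \<xi> m"

text \<open>The parameters \<open>u\<close>, \<open>W\<close> and \<open>h\<close> leave room on the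
  proper side of the uniform exponent, the exponent and the growth ratio, so each bound holds from
  some index on. The witness is the minimiser over \<open>{1..n - 1}\<close>. The by-product
  \<open>u < W\<close> later yields the comparison of the two exponents.\<close>

lemma pred_record_exists:
  assumes hat: "exponent_v_hat b a \<xi> \<ge> ereal vh" and u: "0 < u" "u < vh"
    and W: "exponent_v b a \<xi> < ereal W" "W > 0"
    and h: "h > 0" "\<forall>\<^sub>F n in sequentially. real (a (Suc n)) \<le> h * real (a n)"
  shows "\<forall>\<^sub>F n in sequentially. is_record (d \<xi>) n \<longrightarrow>
    (\<exists>m. pred_record (u / h) (u / h / W) \<xi> n m \<and> u < W)"
proof -
  have "ereal u < exponent_v_hat b a \<xi>" using u by (intro less_le_trans[OF _ hat]) simp
  from exponent_v_hat_gtD[OF this]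
  obtain N1 where N1: "\<And>N. N \<ge> N1 \<Longrightarrow> Min (d \<xi> ` {1..N}) < B powr (- (u * real (a N)))"
    by (auto simp: eventually_sequentially)
  obtain N2 where N2: "\<And>n. n \<ge> N2 \<Longrightarrow> B powr (- (W * real (a n))) \<le> d \<xi> n"
    using exponent_v_lessD[OF W(1)] W(2) by (auto simp: eventually_sequentially)
  obtain N3 where N3: "\<And>n. n \<ge> N3 \<Longrightarrow> real (a (Suc n)) \<le> h * real (a n)"
    using h(2) by (auto simp: eventually_sequentially)
  \<comment> \<open>The record \<open>r\<close> is an anchor: minimisers over longer ranges cannot
    lie before it, so the lower bound with \<open>W\<close> applies to them.\<close>
  obtain r where r: "r \<ge> N2" "is_record (d \<xi>) r"
    using records_exist[OF hat _ W(1), of N2] u W(2) by force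
  show ?thesis
  proof (intro eventually_sequentiallyI impI)
    fix n assume n: "n \<ge> N1 + N3 + r + 1" and rec: "is_record (d \<xi>) n"
    have r1: "r \<ge> 1" "\<And>m. m \<in> {1..<r} \<Longrightarrow> d \<xi> r < d \<xi> m" using r(2) by (auto simp: is_record_def)
    define N where "N = n - 1"
    have N: "n = Suc N" "N \<ge> 1" "N \<ge> N1" "N \<ge> N3" "N \<ge> r" using n r1 by (auto simp: N_def)
    obtain m where m: "m \<in> {1..N}" "is_record (d \<xi>) m" "\<And>k. k \<in> {1..N} \<Longrightarrow> d \<xi> m \<le> d \<xi> k"
      using record_argmin[OF N(2)] by blast
    have "m \<ge> r" using m(3)[of r] r1(2)[of m] m(1) r1(1) N by force
    have "Min (d \<xi> ` {1..N}) \<in> d \<xi> ` {1..N}" using N by (intro Min_in) auto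
    then have "d \<xi> m \<le> Min (d \<xi> ` {1..N})" using m(3) by auto
    then have dm: "d \<xi> m < B powr (- (u * real (a N)))" using N1[of N] N by linarith
    \<comment> \<open>The uniform bound is available at \<open>N = n - 1\<close>; passing to
      \<open>n\<close> costs the factor \<open>h\<close>, which is the origin of the constant
      \<open>u / h\<close>.\<close>
    have "real (a n) \<le> h * real (a N)" using N3 N by simp
    then have "u / h * real (a n) \<le> u * real (a N)" using u h by (simp add: field_simps)
    then have "B powr (- (u * real (a N))) \<le> B powr (- (u / h * real (a n)))" by simp
    then have dc: "d \<xi> m \<le> B powr (- (u / h * real (a n)))" using dm by linarith
    have dW: "B powr (- (W * real (a m))) \<le> d \<xi> m" using N2 \<open>m \<ge> r\<close> r by simp
    \<comment> \<open>The lower and upper bounds on \<open>d \<xi> m\<close> together compare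
      \<open>a m\<close> with \<open>a n\<close> and produce the constant
      \<open>u / h / W\<close>.\<close>
    from order.trans[OF this dc] have "u / h * real (a n) \<le> W * real (a m)" by simp
    then have "u / h * real (a n) / W \<le> real (a m)"
      using W(2) by (simp only: pos_divide_le_eq mult.commute)
    then have "u / h / W * real (a n) \<le> real (a m)" by simp
    moreover have "B powr (- (W * real (a m))) < B powr (- (u * real (a N)))"
      using dW dm by linarith
    then have "u * real (a N) < W * real (a m)" using B_gt by simp
    \<comment> \<open>If \<open>W \<le> u\<close>, then \<open>a m \<le> a N\<close> would reverse
      the preceding inequality.\<close>
    then have "u < W"
    proof (rule contrapos_pp)
      assume "\<not> u < W"
      then have "W * real (a m) \<le> u * real (a N)"
        using m a_le[of m N] u by (intro mult_mono) auto
      then show "\<not> u * real (a N) < W * real (a m)" by simp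
    qed
    moreover have "1/2 \<le> B powr (real (a n) - real (a m)) * d \<xi> m"
      using rec m N by (intro d_decrease) (auto simp: is_record_def)
    ultimately show "\<exists>m. pred_record (u / h) (u / h / W) \<xi> n m \<and> u < W"
      using dc m N unfolding pred_record_def by (intro exI[of _ m]) auto
  qed
qed

text \<open>The wrap-around lower bound is confronted with the uniform upper bound for
  \<open>d \<xi> m\<close>.\<close>

lemma pred_record_gap:
  assumes "pred_record c \<kappa> \<xi> n m"
  shows "1/2 \<le> B powr ((1 - c) * real (a n) - real (a m))"
    and "real (a m) \<le> (1 - c) * real (a n) + 1"
proof -
  have "1/2 \<le> B powr (real (a n) - real (a m)) * d \<xi> m"
    using assms by (simp add: pred_record_def)
  also have "\<dots> \<le> B powr (real (a n) - real (a m)) * B powr (- (c * real (a n)))"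
    using assms by (intro mult_left_mono) (auto simp: pred_record_def)
  also have "\<dots> = B powr ((1 - c) * real (a n) - real (a m))"
    by (simp add: algebra_simps flip: powr_add)
  finally show *: "1/2 \<le> B powr ((1 - c) * real (a n) - real (a m))" .
  \<comment> \<open>Since \<open>b \<ge> 2\<close>, the factor 1/2 costs at most an additive 1 in
    the exponent.\<close>
  have "B powr (-1) \<le> 1/2" using B_gt by (simp add: powr_minus field_simps)
  then have "B powr (-1) \<le> B powr ((1 - c) * real (a n) - real (a m))" using * by linarith
  then have "-1 \<le> (1 - c) * real (a n) - real (a m)" by (simp only: powr_le_B)
  then show "real (a m) \<le> (1 - c) * real (a n) + 1" by simp
qed

text \<open>With \<open>c = u / h\<close>, the two bounds for \<open>a m\<close> at a record
  \<open>n\<close> give \<open>c / W * a n \<le> (1 - c) * a n + 1\<close>. As \<open>a n\<close> is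
  unbounded along records, the 1 disappears; then the slack \<open>e\<close> tends to 0.\<close>

lemma exponent_inequality:
  assumes hat: "exponent_v_hat b a \<xi> \<ge> ereal vh" "vh > 0"
    and V: "exponent_v b a \<xi> \<le> ereal V" "V \<ge> 0"
    and \<eta>: "\<eta> > 0" "\<And>h. h > \<eta> \<Longrightarrow> \<forall>\<^sub>F n in sequentially. real (a (Suc n)) \<le> h * real (a n)"
  shows "vh \<le> V" "vh \<le> V * (\<eta> - vh)"
proof -
  have ineq: "vh - e \<le> V + e \<and> vh - e \<le> (V + e) * (\<eta> + e - (vh - e))" if e: "0 < e" "e < vh" for e
  proof -
    define u h W where "u = vh - e" and "h = \<eta> + e" and "W = V + e"
    have pos: "0 < u" "u < vh" "0 < h" "0 < W" using e V \<eta> by (auto simp: u_def h_def W_def)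
    have W: "exponent_v b a \<xi> < ereal W"
      using e by (intro le_less_trans[OF V(1)]) (simp add: W_def)
    have "\<forall>\<^sub>F n in sequentially. real (a (Suc n)) \<le> h * real (a n)"
      using \<eta>(2) e by (simp add: h_def)
    from pred_record_exists[OF hat(1) pos(1,2) W pos(4,3) this]
    obtain n0 where n0: "\<And>n. n \<ge> n0 \<Longrightarrow> is_record (d \<xi>) n \<Longrightarrow>
        \<exists>m. pred_record (u / h) (u / h / W) \<xi> n m \<and> u < W"
      by (auto simp: eventually_sequentially)
    have gap: "u < W \<and> u / h * real (a n) \<le> W * ((1 - u / h) * real (a n) + 1)"
      if n: "n \<ge> n0" "is_record (d \<xi>) n" for n
    proof -
      obtain m where m: "pred_record (u / h) (u / h / W) \<xi> n m" "u < W" using n0[OF n] by blast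
      then have "u / h / W * real (a n) \<le> (1 - u / h) * real (a n) + 1"
        using pred_record_gap(2)[OF m(1)] by (auto simp: pred_record_def)
      then have "W * (u / h / W * real (a n)) \<le> W * ((1 - u / h) * real (a n) + 1)"
        using pos(4) by (intro mult_left_mono) auto
      then show ?thesis using m(2) pos(4) by simp
    qed
    have rec: "\<exists>n\<ge>k. n \<ge> n0 \<and> is_record (d \<xi>) n" for k
      using records_exist[OF hat W, of "max k n0"] pos(4) by (metis less_imp_le max.boundedE)
    \<comment> \<open>If the difference \<open>?D\<close> were positive, \<open>?D * a n\<close>
      would exceed \<open>W\<close> at a late enough record.\<close>
    have "u / h \<le> W * (1 - u / h)"
    proof (rule ccontr)
      assume "\<not> u / h \<le> W * (1 - u / h)"
      then have D: "u / h - W * (1 - u / h) > 0" (is "?D > 0") by simp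
      obtain k :: nat where k: "real k > W / ?D" using reals_Archimedean2 by blast
      obtain n where n: "n \<ge> k" "n \<ge> n0" "is_record (d \<xi>) n" using rec by blast
      have "?D * real (a n) \<le> W" using gap[OF n(2,3)] by (simp add: algebra_simps)
      moreover have "n \<ge> 1" using n(3) by (simp add: is_record_def)
      then have "real (a n) \<ge> real k" using a_ge[of n] n(1) by simp
      then have "real (a n) > W / ?D" using k by linarith
      then have "?D * real (a n) > W" using D by (simp only: pos_divide_less_eq mult.commute)
      ultimately show False by linarith
    qed
    then have "h * (u / h) \<le> h * (W * (1 - u / h))" using pos(3) by (intro mult_left_mono) auto
    then have "u \<le> W * (h - u)" using pos(3) by (simp add: algebra_simps)
    moreover have "u < W" using rec gap by blast
    ultimately show ?thesis by (simp add: u_def h_def W_def)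
  qed
  have ev: "\<forall>\<^sub>F e in at_right 0. 0 < e \<and> e < vh"
    using hat(2) eventually_at_right_field by blast
  have lim: "((\<lambda>e. vh - e) \<longlongrightarrow> vh - 0) (at_right 0)"
    "((\<lambda>e. V + e) \<longlongrightarrow> V + 0) (at_right 0)"
    "((\<lambda>e. (V + e) * (\<eta> + e - (vh - e))) \<longlongrightarrow> (V + 0) * (\<eta> + 0 - (vh - 0))) (at_right 0)"
    by (intro tendsto_intros)+
  have "vh - 0 \<le> V + 0"
    using ineq by (intro tendsto_le[OF _ lim(2,1) eventually_mono[OF ev]]) auto
  then show "vh \<le> V" by simp
  have "vh - 0 \<le> (V + 0) * (\<eta> + 0 - (vh - 0))"
    using ineq by (intro tendsto_le[OF _ lim(3,1) eventually_mono[OF ev]]) auto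
  then show "vh \<le> V * (\<eta> - vh)" by simp
qed

section \<open>Null sets from counts of \<open>b\<close>-adic rationals\<close>

text \<open>Dividing the distance by \<open>B ^ a n\<close> turns it into an approximation by a
  \<open>b\<close>-adic rational. Stage \<open>n\<close> then costs at most
  \<open>K * 2 powr s * B powr (- \<sigma> * a n)\<close> with
  \<open>\<sigma> = s * (1 + \<tau>) - \<gamma>\<close>, and \<open>n \<le> a n\<close> gives a
  convergent geometric majorant.\<close>

lemma hausdorff_null_of_count:
  assumes fin: "\<And>n. n \<ge> 1 \<Longrightarrow> finite (A n)"
    and card: "\<And>n. n \<ge> 1 \<Longrightarrow> real (card (A n)) \<le> K * B powr (\<gamma> * real (a n))"
    and X: "\<And>\<xi>. \<xi> \<in> X \<Longrightarrow> \<exists>\<^sub>\<infinity>n. n \<ge> 1 \<and> round (B ^ a n * \<xi>) \<in> A n \<and>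
      d \<xi> n < B powr (- (\<tau> * real (a n)))"
    and s: "s > 0" "\<tau> \<ge> 0" "\<gamma> < s * (1 + \<tau>)"
  shows "hausdorff_measure s X = 0"
proof -
  define C where "C n = (if n \<ge> 1 then (\<lambda>k. of_int k / B ^ a n) ` A n else {})" for n
  define r where "r n = B powr (- ((1 + \<tau>) * real (a n)))" for n
  define \<sigma> where "\<sigma> = s * (1 + \<tau>) - \<gamma>"
  have "\<sigma> > 0" using s by (simp add: \<sigma>_def)
  \<comment> \<open>The count at \<open>n = 1\<close> forces this, as cardinalities are
    nonnegative.\<close>
  have K: "K \<ge> 0"
  proof -
    have "0 \<le> K * B powr (\<gamma> * real (a 1))" using card[of 1] by (rule order.trans[rotated]) auto
    then show ?thesis using B_gt by (simp add: zero_le_mult_iff)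
  qed
  have pow: "B powr (- (\<sigma> * real n)) = (B powr (- \<sigma>)) ^ n" for \<sigma> n
    using B_gt by (simp add: powr_realpow[symmetric] powr_powr)
  show ?thesis
  proof (rule hausdorff_null_limsup[where C = C and r = r])
    show "finite (C n)" for n using fin by (simp add: C_def)
    show "r n \<ge> 0" for n by (simp add: r_def)
    show "r \<longlonglongrightarrow> 0"
    proof (rule tendsto_sandwich[OF _ _ tendsto_const])
      show "\<forall>\<^sub>F n in sequentially. r n \<le> (B powr (- 1)) ^ n"
      proof (intro eventually_sequentiallyI)
        fix n :: nat assume "n \<ge> 1"
        then have "1 * real n \<le> (1 + \<tau>) * real (a n)" using a_ge[of n] s by (intro mult_mono) auto
        then show "r n \<le> (B powr (- 1)) ^ n" unfolding r_def pow[symmetric] by simp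
      qed
      show "(\<lambda>n. (B powr (- 1)) ^ n) \<longlonglongrightarrow> 0"
        using B_gt by (intro LIMSEQ_realpow_zero) (auto simp: powr_minus field_simps)
    qed (simp add: r_def)
    show "summable (\<lambda>n. real (card (C n)) * (2 * r n) powr s)"
    proof (rule summable_comparison_test)
      show "summable (\<lambda>n. K * 2 powr s * (B powr (- \<sigma>)) ^ n)"
        using B_gt \<open>\<sigma> > 0\<close> by (intro summable_mult summable_geometric) (simp add: powr_less_one)
      show "\<exists>N. \<forall>n\<ge>N. norm (real (card (C n)) * (2 * r n) powr s) \<le> K * 2 powr s * (B powr (- \<sigma>)) ^ n"
      proof (intro exI[of _ 1] allI impI)
        fix n :: nat assume n: "n \<ge> 1"
        have "card (C n) \<le> card (A n)" using n fin by (simp add: C_def card_image_le)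
        then have "real (card (C n)) \<le> K * B powr (\<gamma> * real (a n))" using card[OF n] by linarith
        then have "real (card (C n)) * (2 * r n) powr s \<le> K * B powr (\<gamma> * real (a n)) * (2 * r n) powr s"
          by (intro mult_right_mono) auto
        also have "\<dots> = K * 2 powr s * (B powr (\<gamma> * real (a n)) * r n powr s)"
          by (simp add: powr_mult r_def)
        also have "B powr (\<gamma> * real (a n)) * r n powr s = B powr (- (\<sigma> * real (a n)))"
          by (simp add: r_def powr_powr \<sigma>_def algebra_simps flip: powr_add)
        also have "K * 2 powr s * \<dots> \<le> K * 2 powr s * B powr (- (\<sigma> * real n))"
          using K a_ge[OF n] \<open>\<sigma> > 0\<close> by (intro mult_left_mono) auto
        finally show "norm (real (card (C n)) * (2 * r n) powr s) \<le> K * 2 powr s * (B powr (- \<sigma>)) ^ n"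
          by (simp add: pow)
      qed
    qed
    fix \<xi> assume "\<xi> \<in> X"
    from X[OF this] show "\<exists>\<^sub>\<infinity>n. \<exists>c\<in>C n. dist c \<xi> \<le> r n"
    proof (rule frequently_elim1)
      fix n
      assume n: "n \<ge> 1 \<and> round (B ^ a n * \<xi>) \<in> A n \<and> d \<xi> n < B powr (- (\<tau> * real (a n)))"
      have "dist (of_int (round (B ^ a n * \<xi>)) / B ^ a n) \<xi> = d \<xi> n / B ^ a n"
      proof -
        have "of_int (round (B ^ a n * \<xi>)) / B ^ a n - \<xi> =
            (of_int (round (B ^ a n * \<xi>)) - B ^ a n * \<xi>) / B ^ a n"
          using B_gt by (simp add: field_simps)
        then show ?thesis using B_gt by (simp add: dist_real_def d_eq abs_minus_commute)
      qed
      also have "\<dots> \<le> B powr (- (\<tau> * real (a n))) / B ^ a n"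
        using n B_gt by (intro divide_right_mono) auto
      also have "\<dots> = B powr (- (\<tau> * real (a n)) - real (a n))"
        using B_gt by (simp add: powr_realpow powr_diff)
      also have "- (\<tau> * real (a n)) - real (a n) = - ((1 + \<tau>) * real (a n))" by algebra
      also have "B powr \<dots> = r n" by (simp add: r_def)
      finally show "\<exists>c\<in>C n. dist c \<xi> \<le> r n" using n by (auto simp: C_def)
    qed
  qed (rule s)
qed

lemma abs_round_le:
  assumes "\<bar>\<xi>\<bar> \<le> M"
  shows "round (B ^ k * \<xi>) \<in> {y. \<bar>of_int y - of_int 0\<bar> \<le> B ^ k * M + 1}"
proof -
  have "\<bar>B ^ k * \<xi>\<bar> \<le> B ^ k * M" using assms by (simp add: abs_mult mult_left_mono)
  moreover have "\<bar>of_int (round (B ^ k * \<xi>)) - B ^ k * \<xi>\<bar> \<le> 1/2" by (rule of_int_round_abs_le)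
  ultimately show ?thesis unfolding mem_Collect_eq of_int_0 by linarith
qed

lemma hausdorff_dim_exponent_v_infinite: "hausdorff_dim {\<xi>. exponent_v b a \<xi> = \<infinity>} = 0"
proof (rule antisym)
  have "hausdorff_dim {\<xi>. exponent_v b a \<xi> = \<infinity>} \<le> ereal 0"
  proof (rule hausdorff_dim_le)
    fix s :: real assume "s > 0"
    \<comment> \<open>On bounded pieces only finitely many nearest integers occur at each
      \<open>n\<close>, about \<open>B ^ a n\<close> of them.\<close>
    define X where "X j = {\<xi>. exponent_v b a \<xi> = \<infinity> \<and> \<bar>\<xi>\<bar> \<le> real j}" for j :: nat
    have "hausdorff_measure s (X j) = 0" for j
    \<comment> \<open>With this \<open>\<tau>\<close>, \<open>s * (1 + \<tau>) = s + 1\<close>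
      exceeds the trivial counting exponent 1.\<close>
    proof (rule hausdorff_null_of_count[where \<tau> = "1 / s" and \<gamma> = 1])
      let ?A = "\<lambda>n. {y :: int. \<bar>of_int y - of_int 0\<bar> \<le> B ^ a n * real j + 1}"
      show "finite (?A n)" for n by (intro card_int_ball) auto
      show "real (card (?A n)) \<le> (2 * real j + 3) * B powr (1 * real (a n))" for n
      proof -
        have "real (card (?A n)) \<le> 2 * (B ^ a n * real j + 1) + 1" by (intro card_int_ball) auto
        moreover have "1 \<le> B ^ a n" using B_gt by simp
        ultimately have "real (card (?A n)) \<le> (2 * real j + 3) * B ^ a n"
          by (simp add: algebra_simps)
        then show ?thesis using B_gt by (simp add: powr_realpow)
      qed
      fix \<xi> assume \<xi>: "\<xi> \<in> X j"
      then have "\<exists>\<^sub>\<infinity>n. n \<ge> 1 \<and> d \<xi> n < B powr (- (1 / s * real (a n)))"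
        by (intro exponent_v_gtD) (simp add: X_def)
      then show "\<exists>\<^sub>\<infinity>n. n \<ge> 1 \<and> round (B ^ a n * \<xi>) \<in> ?A n \<and> d \<xi> n < B powr (- (1 / s * real (a n)))"
        by (rule frequently_elim1) (use \<xi> abs_round_le[of \<xi> "real j"] in \<open>auto simp: X_def\<close>)
    qed (use \<open>s > 0\<close> in \<open>auto simp: field_simps\<close>)
    then have "hausdorff_measure s (\<Union>j. X j) = 0" by (rule hausdorff_null_UN)
    moreover have "{\<xi>. exponent_v b a \<xi> = \<infinity>} \<subseteq> (\<Union>j. X j)"
      using real_arch_simple by (auto simp: X_def)
    ultimately show "hausdorff_measure s {\<xi>. exponent_v b a \<xi> = \<infinity>} = 0"
      by (rule hausdorff_null_subset)
  qed simp
  then show "hausdorff_dim {\<xi>. exponent_v b a \<xi> = \<infinity>} \<le> 0" by (simp add: zero_ereal_def)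
qed (rule hausdorff_dim_nonneg)

section \<open>Counting nearest integers at records\<close>

text \<open>These are the numerators, over the denominator \<open>b ^ a n\<close>, of the centres of
  the intervals used at stage \<open>n\<close>.\<close>

definition record_digits :: "real set \<Rightarrow> nat \<Rightarrow> int set"
  where "record_digits X n = (\<lambda>\<xi>. round (B ^ a n * \<xi>)) ` {\<xi> \<in> X. is_record (d \<xi>) n}"

lemma finite_record_digits:
  assumes "\<And>\<xi>. \<xi> \<in> X \<Longrightarrow> \<bar>\<xi>\<bar> \<le> M" "M \<ge> 0"
  shows "finite (record_digits X n)"
proof (rule finite_subset)
  show "record_digits X n \<subseteq> {y. \<bar>of_int y - of_int 0\<bar> \<le> B ^ a n * M + 1}"
    unfolding record_digits_def using assms(1) by (auto intro!: abs_round_le simp del: of_int_0)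
  show "finite {y :: int. \<bar>of_int y - of_int 0\<bar> \<le> B ^ a n * M + 1}"
    using assms(2) by (intro card_int_ball) simp
qed

text \<open>Scaling from \<open>a m\<close> to \<open>a n\<close> turns the distance at
  \<open>m\<close> into at most \<open>?L\<close>. Rounding at \<open>n\<close> adds at most 1/2,
  which the gap inequality absorbs into a second copy of \<open>?L\<close>.\<close>

lemma round_near_pred:
  assumes "pred_record c \<kappa> \<xi> n m"
  shows "\<bar>of_int (round (B ^ a n * \<xi>)) - of_int (round (B ^ a m * \<xi>) * int b ^ (a n - a m))\<bar>
    \<le> 2 * B powr ((1 - c) * real (a n) - real (a m))" (is "_ \<le> 2 * ?L")
proof -
  have m: "1 \<le> m" "m < n" "d \<xi> m \<le> B powr (- (c * real (a n)))"
    using assms by (auto simp: pred_record_def)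
  have le: "a m \<le> a n" using a_le m by simp
  define p where "p = B ^ (a n - a m)"
  have p: "p = B powr (real (a n) - real (a m))" "B ^ a n = p * B ^ a m" "p > 0"
    using le B_gt by (simp_all add: p_def powr_realpow[symmetric] flip: powr_add)
  define y z where "y = B ^ a m * \<xi>" and "z = B ^ a n * \<xi>"
  have "z = p * y" using p by (simp add: y_def z_def)
  have "\<bar>p * y - p * of_int (round y)\<bar> = p * d \<xi> m"
    using p(3) by (simp add: d_eq y_def abs_mult flip: right_diff_distrib)
  also have "\<dots> \<le> p * B powr (- (c * real (a n)))"
    using m p by (intro mult_left_mono) auto
  also have "\<dots> = ?L" unfolding p(1) by (simp add: algebra_simps flip: powr_add)
  finally have "\<bar>p * y - p * of_int (round y)\<bar> \<le> ?L" .
  moreover have "\<bar>of_int (round z) - z\<bar> \<le> 1/2" by (rule of_int_round_abs_le)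
  moreover have "1/2 \<le> ?L" by (rule pred_record_gap(1)[OF assms])
  ultimately have "\<bar>of_int (round z) - p * of_int (round y)\<bar> \<le> 2 * ?L"
    unfolding \<open>z = p * y\<close> by linarith
  then show ?thesis by (simp add: y_def z_def p_def mult.commute)
qed

text \<open>The predecessor varies with \<open>\<xi>\<close>, so a union bound runs over all
  admissible \<open>m\<close> and all numerators possible there.\<close>

lemma card_record_digits_step:
  assumes bounded: "\<And>\<xi>. \<xi> \<in> X \<Longrightarrow> \<bar>\<xi>\<bar> \<le> M" "M \<ge> 0"
    and pred: "\<And>\<xi>. \<xi> \<in> X \<Longrightarrow> is_record (d \<xi>) n \<Longrightarrow> \<exists>m. pred_record c \<kappa> \<xi> n m"
  shows "real (card (record_digits X n)) \<le>
    (\<Sum>m | m \<in> {1..<n} \<and> \<kappa> * real (a n) \<le> real (a m).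
      6 * B powr ((1 - c) * real (a n) - real (a m)) * real (card (record_digits X m)))"
proof -
  define L where "L m = B powr ((1 - c) * real (a n) - real (a m))" for m
  define S where "S = {m \<in> {1..<n}. \<kappa> * real (a n) \<le> real (a m)}"
  \<comment> \<open>The condition \<open>1/2 \<le> L m\<close> holds for actual predecessors. It
    gives the count \<open>4 * L m + 1 \<le> 6 * L m\<close>; where it fails, the set is
    empty.\<close>
  define T where "T = (\<lambda>m (k :: int). {y :: int. 1/2 \<le> L m \<and>
    \<bar>of_int y - of_int (k * int b ^ (a n - a m))\<bar> \<le> 2 * L m})"
  have T: "finite (T m k) \<and> real (card (T m k)) \<le> 6 * L m" for m k
  proof (cases "1/2 \<le> L m")
    case True
    then show ?thesis
      using card_int_ball[of "2 * L m" "k * int b ^ (a n - a m)"] unfolding T_def by simp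
  qed (simp add: T_def L_def)
  have fin: "finite (record_digits X m)" for m by (rule finite_record_digits[OF bounded])
  have "record_digits X n \<subseteq> (\<Union>m\<in>S. \<Union>k\<in>record_digits X m. T m k)"
  proof
    fix y assume "y \<in> record_digits X n"
    then obtain \<xi> where \<xi>: "\<xi> \<in> X" "is_record (d \<xi>) n" "y = round (B ^ a n * \<xi>)"
      by (auto simp: record_digits_def)
    obtain m where m: "pred_record c \<kappa> \<xi> n m" using pred[OF \<xi>(1,2)] by blast
    then have "m \<in> S" "round (B ^ a m * \<xi>) \<in> record_digits X m"
      using \<xi> by (auto simp: pred_record_def S_def record_digits_def)
    moreover have "y \<in> T m (round (B ^ a m * \<xi>))"
      using round_near_pred[OF m] pred_record_gap(1)[OF m] unfolding T_def L_def \<xi>(3) by simp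
    ultimately show "y \<in> (\<Union>m\<in>S. \<Union>k\<in>record_digits X m. T m k)" by blast
  qed
  then have "card (record_digits X n) \<le> card (\<Union>m\<in>S. \<Union>k\<in>record_digits X m. T m k)"
    using fin T by (intro card_mono finite_UN_I) (auto simp: S_def)
  also have "\<dots> \<le> (\<Sum>m\<in>S. card (\<Union>k\<in>record_digits X m. T m k))"
    by (rule card_UN_le) (simp add: S_def)
  also have "\<dots> \<le> (\<Sum>m\<in>S. \<Sum>k\<in>record_digits X m. card (T m k))"
    using fin by (intro sum_mono card_UN_le)
  finally have "real (card (record_digits X n)) \<le> (\<Sum>m\<in>S. \<Sum>k\<in>record_digits X m. real (card (T m k)))"
    by (simp flip: of_nat_sum)
  also have "\<dots> \<le> (\<Sum>m\<in>S. \<Sum>k\<in>record_digits X m. 6 * L m)"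
    using T by (intro sum_mono) blast
  finally show ?thesis by (simp add: S_def L_def mult.commute mult.left_commute)
qed

text \<open>Strong induction: inserting the bound at \<open>m\<close> leaves the exponent
  \<open>(1 - c) * a n - (1 - \<gamma>) * a m\<close>, which is at most
  \<open>(\<gamma> - \<sigma>) * a n\<close> because \<open>\<kappa> * a n \<le> a m\<close>. The
  gain \<open>B powr (- \<sigma> * a n)\<close> eventually absorbs both the factor 6 and the number
  of possible \<open>m\<close>.\<close>

lemma card_record_digits:
  assumes bounded: "\<And>\<xi>. \<xi> \<in> X \<Longrightarrow> \<bar>\<xi>\<bar> \<le> M" "M \<ge> 0"
    and pred: "\<And>\<xi> n. \<xi> \<in> X \<Longrightarrow> n \<ge> n0 \<Longrightarrow> is_record (d \<xi>) n \<Longrightarrow> \<exists>m. pred_record c \<kappa> \<xi> n m"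
    and \<gamma>: "0 < \<gamma>" "\<gamma> < 1" "1 - c - (1 - \<gamma>) * \<kappa> < \<gamma>"
  obtains K where "\<And>n. n \<ge> 1 \<Longrightarrow> real (card (record_digits X n)) \<le> K * B powr (\<gamma> * real (a n))"
proof -
  define \<sigma> where "\<sigma> = \<gamma> - (1 - c - (1 - \<gamma>) * \<kappa>)"
  have "\<sigma> > 0" using \<gamma> by (simp add: \<sigma>_def)
  then have "B powr \<sigma> > 1" using B_gt by simp
  then have "(\<lambda>n. of_nat n / (B powr \<sigma>) ^ n) \<longlonglongrightarrow> 0" by (intro lim_n_over_pown) simp
  then have "\<forall>\<^sub>F n in sequentially. real n / (B powr \<sigma>) ^ n < 1/6"
    by (rule order_tendstoD) simp
  then obtain N where N: "\<And>n. n \<ge> N \<Longrightarrow> real n / (B powr \<sigma>) ^ n < 1/6"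
    by (auto simp: eventually_sequentially)
  define n1 where "n1 = n0 + N + 1"
  define c' where "c' n = real (card (record_digits X n))" for n
  define K where "K = (\<Sum>n\<le>n1. c' n)"
  have "K \<ge> 0" by (simp add: K_def c'_def sum_nonneg)
  have "c' n \<le> K * B powr (\<gamma> * real (a n))" if "n \<ge> 1" for n
    using that
  proof (induction n rule: less_induct)
    case (less n)
    show ?case
    proof (cases "n \<le> n1")
      case True
      then have "c' n \<le> K" unfolding K_def by (intro member_le_sum) (auto simp: c'_def)
      also have "K * 1 \<le> K * B powr (\<gamma> * real (a n))"
        using \<open>K \<ge> 0\<close> \<gamma> B_gt by (intro mult_left_mono ge_one_powr_ge_zero) auto
      finally show ?thesis by simp
    next
      case False
      define S where "S = {m \<in> {1..<n}. \<kappa> * real (a n) \<le> real (a m)}"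
      define Q where "Q = K * B powr (\<gamma> * real (a n))"
      have "c' n \<le> (\<Sum>m\<in>S. 6 * B powr ((1 - c) * real (a n) - real (a m)) * c' m)"
        unfolding c'_def S_def using False pred
        by (intro card_record_digits_step[OF bounded]) (auto simp: n1_def)
      also have "\<dots> \<le> (\<Sum>m\<in>S. 6 * (Q * B powr (- (\<sigma> * real (a n)))))"
      proof (rule sum_mono)
        fix m assume m: "m \<in> S"
        have "6 * B powr ((1 - c) * real (a n) - real (a m)) * c' m \<le>
            6 * B powr ((1 - c) * real (a n) - real (a m)) * (K * B powr (\<gamma> * real (a m)))"
          using m less by (intro mult_left_mono) (auto simp: S_def)
        also have "\<dots> = 6 * (K * B powr ((1 - c) * real (a n) - (1 - \<gamma>) * real (a m)))"
          by (simp add: algebra_simps flip: powr_add)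
        also have "\<dots> \<le> 6 * (K * B powr ((1 - c) * real (a n) - (1 - \<gamma>) * (\<kappa> * real (a n))))"
          using m \<open>K \<ge> 0\<close> \<gamma> by (intro mult_left_mono) (auto simp: S_def mult_left_mono)
        also have "\<dots> = 6 * (Q * B powr (- (\<sigma> * real (a n))))"
          by (simp add: Q_def \<sigma>_def algebra_simps flip: powr_add)
        finally show "6 * B powr ((1 - c) * real (a n) - real (a m)) * c' m \<le>
          6 * (Q * B powr (- (\<sigma> * real (a n))))" .
      qed
      also have "\<dots> = real (card S) * (6 * (Q * B powr (- (\<sigma> * real (a n)))))" by simp
      also have "\<dots> \<le> real (a n) * (6 * (Q * B powr (- (\<sigma> * real (a n)))))"
      proof (intro mult_right_mono)
        have "card S \<le> card {1..<n}" by (rule card_mono) (auto simp: S_def)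
        then show "real (card S) \<le> real (a n)" using a_ge[OF less.prems] by simp
      qed (use \<open>K \<ge> 0\<close> in \<open>simp add: Q_def\<close>)
      also have "\<dots> = Q * (6 * (real (a n) / (B powr \<sigma>) ^ a n))"
        using B_gt by (simp add: powr_realpow[symmetric] powr_powr powr_minus field_simps)
      also have "\<dots> \<le> Q * 1"
      proof (rule mult_left_mono)
        show "6 * (real (a n) / (B powr \<sigma>) ^ a n) \<le> 1"
        proof -
          have "a n \<ge> N" using a_ge[OF less.prems] False by (simp add: n1_def)
          from N[OF this] show ?thesis by linarith
        qed
      qed (use \<open>K \<ge> 0\<close> in \<open>simp add: Q_def\<close>)
      finally show ?thesis by (simp add: Q_def)
    qed
  qed
  then show ?thesis using that unfolding c'_def by blast
qed

section \<open>Dimension bound for prescribed ranges of the exponents\<close>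

lemma hausdorff_null_pred_record:
  assumes pred: "\<And>\<xi>. \<xi> \<in> E \<Longrightarrow>
      \<forall>\<^sub>F n in sequentially. is_record (d \<xi>) n \<longrightarrow> (\<exists>m. pred_record c \<kappa> \<xi> n m)"
    and good: "\<And>\<xi>. \<xi> \<in> E \<Longrightarrow>
      \<exists>\<^sub>\<infinity>n. is_record (d \<xi>) n \<and> d \<xi> n < B powr (- (\<tau> * real (a n)))"
    and \<gamma>: "0 < \<gamma>" "\<gamma> < 1" "1 - c - (1 - \<gamma>) * \<kappa> < \<gamma>"
    and s: "s > 0" "\<tau> \<ge> 0" "\<gamma> < s * (1 + \<tau>)"
  shows "hausdorff_measure s E = 0"
proof -
  \<comment> \<open>Both the size of \<open>\<xi>\<close> and the index from which predecessors
    exist depend on \<open>\<xi>\<close>; on each \<open>X j\<close> they are uniform, as the count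
    requires.\<close>
  define X where "X j = {\<xi> \<in> E. \<bar>\<xi>\<bar> \<le> real j \<and>
    (\<forall>n\<ge>j. is_record (d \<xi>) n \<longrightarrow> (\<exists>m. pred_record c \<kappa> \<xi> n m))}" for j :: nat
  have "hausdorff_measure s (X j) = 0" for j
  proof -
    obtain K where "\<And>n. n \<ge> 1 \<Longrightarrow> real (card (record_digits (X j) n)) \<le> K * B powr (\<gamma> * real (a n))"
      by (rule card_record_digits[of "X j" "real j" j c \<kappa> \<gamma>]) (use \<gamma> in \<open>auto simp: X_def\<close>)
    moreover have "finite (record_digits (X j) n)" for n
      by (rule finite_record_digits[of _ "real j"]) (auto simp: X_def)
    moreover have "\<exists>\<^sub>\<infinity>n. n \<ge> 1 \<and> round (B ^ a n * \<xi>) \<in> record_digits (X j) n \<and>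
      d \<xi> n < B powr (- (\<tau> * real (a n)))" if "\<xi> \<in> X j" for \<xi>
    proof -
      have "\<xi> \<in> E" using that by (simp add: X_def)
      from good[OF this] show ?thesis
        by (rule frequently_elim1) (use that in \<open>auto simp: record_digits_def is_record_def\<close>)
    qed
    ultimately show ?thesis using s
      by (intro hausdorff_null_of_count[where A = "record_digits (X j)" and K = K])
  qed
  then have "hausdorff_measure s (\<Union>j. X j) = 0" by (rule hausdorff_null_UN)
  moreover have "E \<subseteq> (\<Union>j. X j)"
  proof
    fix \<xi> assume "\<xi> \<in> E"
    from pred[OF this] obtain n0 where
      n0: "\<And>n. n \<ge> n0 \<Longrightarrow> is_record (d \<xi>) n \<Longrightarrow> \<exists>m. pred_record c \<kappa> \<xi> n m"
      by (auto simp: eventually_sequentially)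
    obtain j :: nat where "\<bar>\<xi>\<bar> \<le> real j" using real_arch_simple by blast
    then have "\<xi> \<in> X (max n0 j)" using \<open>\<xi> \<in> E\<close> n0 by (auto simp: X_def)
    then show "\<xi> \<in> (\<Union>j. X j)" by blast
  qed
  ultimately show ?thesis by (rule hausdorff_null_subset)
qed

text \<open>The exponent provides good approximations at arbitrary indices. The thresholds decrease
  with the index, so each can be moved to a minimiser, which is a record.\<close>

lemma infinitely_many_good_records:
  assumes hat: "exponent_v_hat b a \<xi> \<ge> ereal vh" "vh > 0"
    and W: "exponent_v b a \<xi> < ereal W" "W \<ge> 0"
    and \<tau>: "ereal \<tau> < exponent_v b a \<xi>" "\<tau> \<ge> 0"
  shows "\<exists>\<^sub>\<infinity>n. is_record (d \<xi>) n \<and> d \<xi> n < B powr (- (\<tau> * real (a n)))"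
  unfolding INFM_nat_le
proof
  fix k
  obtain r where r: "r \<ge> k" "is_record (d \<xi>) r" by (rule records_exist[OF hat W])
  have "\<exists>\<^sub>\<infinity>n. d \<xi> n < B powr (- (\<tau> * real (a n)))"
    using exponent_v_gtD[OF \<tau>(1)] by (rule frequently_elim1) blast
  moreover have "B powr (- (\<tau> * real (a n))) \<le> B powr (- (\<tau> * real (a m)))"
    if "1 \<le> m" "m \<le> n" for m n
    using a_le[OF that] \<tau>(2) by (simp add: mult_left_mono)
  ultimately obtain m where "m \<ge> r" "is_record (d \<xi>) m" "d \<xi> m < B powr (- (\<tau> * real (a m)))"
    by (rule small_value_imp_small_record[OF r(2)])
  then show "\<exists>n\<ge>k. is_record (d \<xi>) n \<and> d \<xi> n < B powr (- (\<tau> * real (a n)))"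
    using r(1) by (meson order.trans)
qed

text \<open>In the limit \<open>c = vh / \<eta>\<close> and \<open>\<kappa> = c / V\<close>, the
  counting condition says exactly \<open>\<gamma> > f\<close>, with \<open>f\<close> as defined in
  the proof. The upper bound \<open>V\<close> thus governs the count, while the lower bound
  \<open>T\<close> governs the radii; together they give dimension at most
  \<open>f / (1 + T)\<close>.\<close>

lemma hausdorff_dim_exponents_between:
  assumes vh: "vh > 0" and \<eta>: "\<eta> > 0"
      "\<And>h. h > \<eta> \<Longrightarrow> \<forall>\<^sub>F n in sequentially. real (a (Suc n)) \<le> h * real (a n)"
    and T: "0 < T" "T \<le> V" and V: "vh \<le> V * (\<eta> - vh)"
  shows "hausdorff_dim {\<xi>. exponent_v_hat b a \<xi> \<ge> ereal vh \<and>
      ereal T \<le> exponent_v b a \<xi> \<and> exponent_v b a \<xi> \<le> ereal V}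
    \<le> ereal ((\<eta> * V - vh - vh * V) / ((1 + T) * (\<eta> * V - vh)))" (is "hausdorff_dim ?E \<le> _")
proof (rule hausdorff_dim_le)
  have "V > 0" using T by simp
  have "V * vh > 0" using vh \<open>V > 0\<close> by simp
  then have \<eta>V: "\<eta> * V - vh > 0" using V by (simp add: algebra_simps)
  have num: "\<eta> * V - vh - vh * V \<ge> 0" using V by (simp add: algebra_simps)
  show "(\<eta> * V - vh - vh * V) / ((1 + T) * (\<eta> * V - vh)) \<ge> 0"
    using num \<eta>V T by (intro divide_nonneg_nonneg mult_nonneg_nonneg) auto
  fix s assume s: "s > (\<eta> * V - vh - vh * V) / ((1 + T) * (\<eta> * V - vh))"
  define f where "f = (\<eta> * V - vh - vh * V) / (\<eta> * V - vh)"
  have f: "f \<ge> 0" using num \<eta>V by (simp add: f_def)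
  have "f < 1" using \<eta>V vh \<open>V > 0\<close> by (simp add: f_def)
  moreover have sf: "f / (1 + T) < s" using s by (simp add: f_def mult.commute)
  then have "f < s * (1 + T)" using T by (simp add: pos_divide_less_eq)
  \<comment> \<open>The counting exponent lies strictly between \<open>f\<close> and the value at
    which the covering sum would stop converging, and below 1.\<close>
  ultimately obtain \<gamma> where \<gamma>: "f < \<gamma>" "\<gamma> < 1" "\<gamma> < s * (1 + T)"
    using dense[of f "min 1 (s * (1 + T))"] by auto
  have "f / (1 + T) \<ge> 0" using f T by simp
  then have "s > 0" using sf by linarith
  \<comment> \<open>The exponents and the growth ratio are relaxed by a common slack
    \<open>e\<close>. The required inequalities are strict at \<open>e = 0\<close> and continuous
    there, so they survive for small positive \<open>e\<close>.\<close>
  define c where "c e = (vh - e) / (\<eta> + e)" for e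
  have "((\<lambda>e. 1 - c e - (1 - \<gamma>) * (c e / (V + e))) \<longlongrightarrow>
      1 - (vh - 0) / (\<eta> + 0) - (1 - \<gamma>) * ((vh - 0) / (\<eta> + 0) / (V + 0))) (at_right 0)"
    unfolding c_def using \<eta> \<open>V > 0\<close> by (intro tendsto_intros) auto
  moreover have "1 - (vh - 0) / (\<eta> + 0) - (1 - \<gamma>) * ((vh - 0) / (\<eta> + 0) / (V + 0)) < \<gamma>"
  proof -
    have "\<eta> * V - vh - vh * V < \<gamma> * (\<eta> * V - vh)"
      using \<gamma>(1) \<eta>V by (simp add: f_def pos_divide_less_eq)
    then have "(\<eta> * V - vh * V - (1 - \<gamma>) * vh) / (\<eta> * V) < \<gamma>"
      using \<eta>(1) \<open>V > 0\<close> by (simp add: pos_divide_less_eq algebra_simps)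
    also have "(\<eta> * V - vh * V - (1 - \<gamma>) * vh) / (\<eta> * V) = 1 - vh / \<eta> - (1 - \<gamma>) * (vh / \<eta> / V)"
      using \<eta>(1) \<open>V > 0\<close> by (simp add: field_simps)
    finally show ?thesis by simp
  qed
  ultimately have ev1: "\<forall>\<^sub>F e in at_right 0. 1 - c e - (1 - \<gamma>) * (c e / (V + e)) < \<gamma>"
    by (rule order_tendstoD)
  have "((\<lambda>e. s * (1 + (T - e))) \<longlongrightarrow> s * (1 + (T - 0))) (at_right 0)"
    by (intro tendsto_intros)
  then have ev2: "\<forall>\<^sub>F e in at_right 0. \<gamma> < s * (1 + (T - e))"
    by (rule order_tendstoD) (use \<gamma> in simp)
  have "\<forall>\<^sub>F e in at_right 0. 0 < e \<and> e < min vh T"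
    unfolding eventually_at_right_field using vh T by (intro exI[of _ "min vh T"]) simp
  with ev1 ev2 have "\<forall>\<^sub>F e in at_right 0. 1 - c e - (1 - \<gamma>) * (c e / (V + e)) < \<gamma> \<and>
      \<gamma> < s * (1 + (T - e)) \<and> 0 < e \<and> e < min vh T"
    by eventually_elim simp
  then obtain e where e: "1 - c e - (1 - \<gamma>) * (c e / (V + e)) < \<gamma>"
      "\<gamma> < s * (1 + (T - e))" "0 < e" "e < vh" "e < T"
    using eventually_happens[of _ "at_right (0::real)"] by force
  show "hausdorff_measure s ?E = 0"
  proof (rule hausdorff_null_pred_record[where c = "c e" and \<kappa> = "c e / (V + e)"
        and \<tau> = "T - e" and \<gamma> = \<gamma>])
    fix \<xi> assume \<xi>: "\<xi> \<in> ?E"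
    then have hat: "exponent_v_hat b a \<xi> \<ge> ereal vh" by simp
    have W: "exponent_v b a \<xi> < ereal (V + e)"
      using \<xi> e(3) le_less_trans[of "exponent_v b a \<xi>" "ereal V" "ereal (V + e)"] by simp
    have \<tau>: "ereal (T - e) < exponent_v b a \<xi>"
      using \<xi> e(3) less_le_trans[of "ereal (T - e)" "ereal T"] by simp
    show "\<forall>\<^sub>F n in sequentially. is_record (d \<xi>) n \<longrightarrow>
        (\<exists>m. pred_record (c e) (c e / (V + e)) \<xi> n m)"
      using pred_record_exists[OF hat, of "vh - e" "V + e" "\<eta> + e"] W \<eta>(2)[of "\<eta> + e"] \<eta>(1) e \<open>V > 0\<close>
      unfolding c_def by (auto elim!: eventually_mono)
    show "\<exists>\<^sub>\<infinity>n. is_record (d \<xi>) n \<and> d \<xi> n < B powr (- ((T - e) * real (a n)))"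
      using e \<open>V > 0\<close> by (intro infinitely_many_good_records[OF hat vh W _ \<tau>]) auto
  qed (use \<gamma> e f \<open>s > 0\<close> in auto)
qed

end

theorem theorem1p5:
  fixes b :: nat and a :: "nat \<Rightarrow> nat" and \<eta> :: real
  assumes "b \<ge> 2"
    and "\<And>n. n \<ge> 1 \<Longrightarrow> a n > 0"
    and "strict_mono_on {1..} a"
    and "limsup (\<lambda>n. ereal (real (a (Suc n)) / real (a n))) = ereal \<eta>"
  shows "(\<forall>\<theta> vh :: real. \<theta> > 0 \<and> vh > 0 \<and> vh < \<eta> \<longrightarrow>
      (\<theta> < max 1 (1 / (\<eta> - vh)) \<longrightarrow>
        V_hat b a vh \<inter> V_star b a (ereal (\<theta> * vh)) = {}) \<and>
      (\<theta> \<ge> max 1 (1 / (\<eta> - vh)) \<longrightarrow>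
        hausdorff_dim (V_hat b a vh \<inter> V_star b a (ereal (\<theta> * vh)))
          \<le> ereal ((\<eta> * \<theta> - 1 - \<theta> * vh) / ((\<eta> * \<theta> - 1) * (1 + \<theta> * vh)))) \<and>
      (\<theta> \<ge> max 1 (1 / (\<eta> - vh)) \<longrightarrow> (\<forall>\<rho> :: real. \<rho> \<ge> 0 \<longrightarrow>
        hausdorff_dim {\<xi> :: real. exponent_v_hat b a \<xi> \<ge> ereal vh \<and>
            ereal (\<theta> * vh) \<le> exponent_v b a \<xi> \<and> exponent_v b a \<xi> \<le> ereal (\<theta> * vh + \<rho>)}
          \<le> ereal ((vh * (\<eta> * \<theta> - 1 - \<theta> * vh) + \<rho> * (\<eta> - vh)) /
              ((1 + \<theta> * vh) * ((\<eta> * \<theta> - 1) * vh + \<eta> * \<rho>)))))) \<and>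
    hausdorff_dim (V_hat b a \<eta>) = 0"
proof -
  interpret digit_positions b a using assms(1-3) by unfold_locales
  have ratio: "\<forall>\<^sub>F n in sequentially. real (a (Suc n)) \<le> h * real (a n)" if "h > \<eta>" for h
  proof -
    have "\<forall>\<^sub>F n in sequentially. ereal (real (a (Suc n)) / real (a n)) < ereal h"
      using that assms(4) by (intro Limsup_lessD) simp
    with eventually_ge_at_top[of 1] show ?thesis
    proof eventually_elim
      case (elim n)
      then show ?case using assms(2)[of n] by (simp add: pos_divide_less_eq)
    qed
  qed
  \<comment> \<open>All ratios of consecutive terms are at least 1; only positivity of
    \<open>\<eta>\<close> is drawn from this.\<close>
  have "\<eta> \<ge> 1"
  proof -
    have "\<forall>\<^sub>F n in sequentially. (1 :: ereal) \<le> ereal (real (a (Suc n)) / real (a n))"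
    proof (rule eventually_sequentiallyI)
      fix n :: nat assume "n \<ge> 1"
      then show "(1 :: ereal) \<le> ereal (real (a (Suc n)) / real (a n))"
        using a_less[of n "Suc n"] assms(2)[of n] by simp
    qed
    then have "1 \<le> limsup (\<lambda>n. ereal (real (a (Suc n)) / real (a n)))"
      by (intro le_Limsup) auto
    then show ?thesis using assms(4) by simp
  qed
  then have "\<eta> > 0" by simp
  have dim: "hausdorff_dim {\<xi> :: real. exponent_v_hat b a \<xi> \<ge> ereal vh \<and>
        ereal (\<theta> * vh) \<le> exponent_v b a \<xi> \<and> exponent_v b a \<xi> \<le> ereal (\<theta> * vh + \<rho>)}
      \<le> ereal ((vh * (\<eta> * \<theta> - 1 - \<theta> * vh) + \<rho> * (\<eta> - vh)) /
        ((1 + \<theta> * vh) * ((\<eta> * \<theta> - 1) * vh + \<eta> * \<rho>)))"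
    if h: "\<theta> > 0" "vh > 0" "vh < \<eta>" "\<theta> \<ge> max 1 (1 / (\<eta> - vh))" "\<rho> \<ge> 0" for \<theta> vh \<rho>
  proof -
    have "1 \<le> \<theta> * (\<eta> - vh)" using h by (simp add: pos_divide_le_eq)
    then have "vh * 1 \<le> vh * (\<theta> * (\<eta> - vh))" using h(2) by (intro mult_left_mono) auto
    also have "\<dots> = \<theta> * vh * (\<eta> - vh)" by simp
    also have "\<dots> \<le> (\<theta> * vh + \<rho>) * (\<eta> - vh)" using h by (intro mult_right_mono) auto
    finally have "vh \<le> (\<theta> * vh + \<rho>) * (\<eta> - vh)" by simp
    \<comment> \<open>For \<open>T = \<theta> * vh\<close> and
      \<open>V = \<theta> * vh + \<rho>\<close>, expanding numerator and denominator gives the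
      stated quotient.\<close>
    from hausdorff_dim_exponents_between[OF h(2) \<open>\<eta> > 0\<close> ratio, of "\<theta> * vh" "\<theta> * vh + \<rho>", OF _ _ _ this]
    show ?thesis using h by (simp add: algebra_simps)
  qed
  have "V_hat b a vh \<inter> V_star b a (ereal (\<theta> * vh)) = {}"
    if h: "\<theta> > 0" "vh > 0" "vh < \<eta>" "\<theta> < max 1 (1 / (\<eta> - vh))" for \<theta> vh
  proof (rule ccontr)
    assume "V_hat b a vh \<inter> V_star b a (ereal (\<theta> * vh)) \<noteq> {}"
    then obtain \<xi> where \<xi>: "exponent_v_hat b a \<xi> \<ge> ereal vh" "exponent_v b a \<xi> \<le> ereal (\<theta> * vh)"
      unfolding V_hat_def V_star_def by (blast intro: eq_refl)
    have "vh \<le> \<theta> * vh" "vh \<le> \<theta> * vh * (\<eta> - vh)"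
      using exponent_inequality[OF \<xi>(1) h(2) \<xi>(2) _ \<open>\<eta> > 0\<close> ratio] h by auto
    then have "vh * 1 \<le> vh * \<theta>" "vh * 1 \<le> vh * (\<theta> * (\<eta> - vh))" by (simp_all add: mult_ac)
    then have "1 \<le> \<theta>" "1 \<le> \<theta> * (\<eta> - vh)" using h(2) by (simp_all only: mult_le_cancel_left_pos)
    then show False using h by (simp add: less_max_iff_disj pos_less_divide_eq)
  qed
  moreover have "hausdorff_dim (V_hat b a vh \<inter> V_star b a (ereal (\<theta> * vh)))
      \<le> ereal ((\<eta> * \<theta> - 1 - \<theta> * vh) / ((\<eta> * \<theta> - 1) * (1 + \<theta> * vh)))"
    if h: "\<theta> > 0" "vh > 0" "vh < \<eta>" "\<theta> \<ge> max 1 (1 / (\<eta> - vh))" for \<theta> vh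
  proof -
    have "V_hat b a vh \<inter> V_star b a (ereal (\<theta> * vh)) = {\<xi>. exponent_v_hat b a \<xi> \<ge> ereal vh \<and>
        ereal (\<theta> * vh) \<le> exponent_v b a \<xi> \<and> exponent_v b a \<xi> \<le> ereal (\<theta> * vh + 0)}"
      by (auto simp: V_hat_def V_star_def)
    \<comment> \<open>For \<open>\<rho> = 0\<close> a common factor \<open>vh\<close> cancels from
      the quotient.\<close>
    then show ?thesis using dim[OF h, of 0] h(2) by (simp add: mult_ac)
  qed
  moreover have "hausdorff_dim (V_hat b a \<eta>) = 0"
  proof (rule antisym[OF _ hausdorff_dim_nonneg])
    have "V_hat b a \<eta> \<subseteq> {\<xi>. exponent_v b a \<xi> = \<infinity>}"
    proof
      fix \<xi> assume \<xi>: "\<xi> \<in> V_hat b a \<eta>"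
      show "\<xi> \<in> {\<xi>. exponent_v b a \<xi> = \<infinity>}"
      proof (rule ccontr)
        assume "\<xi> \<notin> {\<xi>. exponent_v b a \<xi> = \<infinity>}"
        then obtain r where "exponent_v b a \<xi> \<le> ereal r"
          by (cases "exponent_v b a \<xi>") auto
        then obtain V where "exponent_v b a \<xi> \<le> ereal V" "V \<ge> 0"
          using order.trans[of "exponent_v b a \<xi>" "ereal r" "ereal (max 0 r)"] that[of "max 0 r"]
          by simp
        \<comment> \<open>At \<open>vh = \<eta>\<close> the inequality reads
          \<open>\<eta> \<le> V * 0\<close>, against \<open>\<eta> > 0\<close>.\<close>
        then show False
          using exponent_inequality(2)[of \<eta> \<xi> V \<eta>] \<xi> ratio \<open>\<eta> > 0\<close> by (simp add: V_hat_def)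
      qed
    qed
    then have "hausdorff_dim (V_hat b a \<eta>) \<le> hausdorff_dim {\<xi>. exponent_v b a \<xi> = \<infinity>}"
      by (rule hausdorff_dim_mono)
    then show "hausdorff_dim (V_hat b a \<eta>) \<le> 0" by (simp add: hausdorff_dim_exponent_v_infinite)
  qed
  ultimately show ?thesis using dim by (intro conjI allI impI) auto
qed

end
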